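(* Fix any $\delta\in(0,1]$, and let $K=\Theta(\log(1/\delta))$. Given $N$ i.i.d. samples from an unknown probability distribution $P$ over a finite alphabet $\Sigma$, with probability at least $1-\delta$ the add-$K$ estimator yields a hypothesis $\hat P$ such that $$d_{\chi^2}(P,\hat P)\le C\,\frac{|\Sigma|\log(|\Sigma|/\delta)}{N},$$ where $C$ is an absolute constant. In particular, $N=O\left(\frac{|\Sigma|}{\varepsilon}\log\frac{|\Sigma|}{\delta}\right)$ samples suffice to learn $P$ to $\chi^2$ divergence $\varepsilon$ with probability $1-\delta$.
   Context: For distributions $P,Q$ on $\Sigma$, $d_{\chi^2}(P,Q)=\sum_{i\in\Sigma}\frac{(P(i)-Q(i))^2}{Q(i)}$. Given $N$ i.i.d. samples from a distribution over $\Sigma$ with empirical counts $N_i$, $i\in\Sigma$, the add-$K$ estimator is $\hat P(i)=\frac{N_i+K}{N+K|\Sigma|}$ for $i\in\Sigma$. To learn $P$ to $\chi^2$ divergence $\varepsilon$ (where $\varepsilon>0$) means to output $\hat P$ with $d_{\chi^2}(P,\hat P)\le\varepsilon$. $O(\cdot)$ and $\Theta(\cdot)$ are the standard asymptotic notations, with absolute constants.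
   Formalization: K = Θ(log(1/δ)) is imposed as two-sided bounds only for δ ≤ δ0, with any fixed δ0 < 1; for δ in (δ0,1] K lies between positive constants, as the claim fails when K tends to 0 as δ tends to 1. C depends on the Θ constants and δ0. *)

theory Defs
  imports "HOL-Probability.Probability"
begin

definition chi2_div :: "'a set \<Rightarrow> ('a \<Rightarrow> real) \<Rightarrow> ('a \<Rightarrow> real) \<Rightarrow> real" where
  "chi2_div \<Sigma> P Q = (\<Sum>i\<in>\<Sigma>. (P i - Q i)^2 / Q i)"

definition add_K_estimator :: "'a set \<Rightarrow> real \<Rightarrow> 'a list \<Rightarrow> 'a \<Rightarrow> real" where
  "add_K_estimator \<Sigma> K xs i =
     (real (count_list xs i) + K) / (real (length xs) + K * real (card \<Sigma>))"

(* "K = Theta(log(1/d))" with explicit constants c1, c2 and threshold d0: the usual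
   asymptotic notion for d -> 0, i.e. two-sided bounds for all d <= d0. To the right of d0,
   where Theta says nothing (and log(1/d) degenerates to 0 at d = 1), K is of constant order. *)
definition Theta_log_inverse :: "real \<Rightarrow> real \<Rightarrow> real \<Rightarrow> real \<Rightarrow> real \<Rightarrow> bool" where
  "Theta_log_inverse c1 c2 \<delta>0 \<delta> K \<longleftrightarrow>
     (if \<delta> \<le> \<delta>0 then c1 * ln (1 / \<delta>) \<le> K \<and> K \<le> c2 * ln (1 / \<delta>)
      else c1 \<le> K \<and> K \<le> c2)"

(* Probability, over N i.i.d. samples from P, that the add-K estimator outputs a hypothesis
   within chi-squared divergence r of P. *)
definition add_K_success_prob :: "'a set \<Rightarrow> 'a pmf \<Rightarrow> nat \<Rightarrow> real \<Rightarrow> real \<Rightarrow> real" where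
  "add_K_success_prob \<Sigma> P N K r =
     measure_pmf.prob (replicate_pmf N P)
       {xs. chi2_div \<Sigma> (pmf P) (add_K_estimator \<Sigma> K xs) \<le> r}"

end

theory Submission
  imports Defs
begin

text \<open>
  Write \<open>c\<close> for the count of a symbol and \<open>m\<close> for its mean. Up to a constant factor and
  a bias of the required order, the divergence is at most \<open>1 / N\<close> times the sum of the
  \<open>(m - c)\<^sup>2 / (c + K)\<close>. Chernoff bounds and a union bound
  make each summand \<open>O(log (|\<Sigma>| / \<delta>))\<close> unless \<open>c < m / 2\<close>, when it can be as large as \<open>m\<^sup>2 / K\<close>.
  This is \<open>O(K)\<close> if \<open>m = O(K)\<close>. For \<open>m\<close> above a large multiple of \<open>K\<close> the event \<open>c < m / 2\<close> has
  probability at most \<open>exp (- m / 16)\<close>, which absorbs both \<open>m\<^sup>2\<close> and a factor \<open>\<delta>\<close> because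
  \<open>K\<close> is at least of order \<open>log (1 / \<delta>)\<close>; so Markov's inequality bounds the sum of these terms by
  \<open>O(|\<Sigma>|)\<close> with failure probability \<open>O(\<delta>)\<close>.
\<close>

section \<open>Exponential moments and tail bounds for a single count\<close>

text \<open>Makes Chernoff exponents quadratic in the parameter, hence easy to optimise. For
  negative \<open>s\<close>, multiplying by \<open>1 - s\<close> turns the left side into at most 1
  and the right side into \<open>1 - s^3\<close>, which is at least 1.\<close>

lemma exp_le_quadratic:
  fixes s :: real
  assumes "\<bar>s\<bar> \<le> 1"
  shows "exp s \<le> 1 + s + s\<^sup>2"
proof (cases "s \<ge> 0")
  case True
  then show ?thesis using exp_bound[of s] assms by simp
next
  case False
  then have "s\<^sup>2 * s \<le> 0"
    by (simp add: mult_nonneg_nonpos)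
  have "exp s * (1 - s) \<le> exp s * exp (- s)"
    using exp_ge_add_one_self[of "- s"] by (intro mult_left_mono) auto
  also have "\<dots> = 1"
    by (simp flip: exp_add)
  also have "1 \<le> (1 + s + s\<^sup>2) * (1 - s)"
    using \<open>s\<^sup>2 * s \<le> 0\<close> by (simp add: algebra_simps power2_eq_square)
  finally show ?thesis
    using False by simp
qed

text \<open>The right side is the exponential moment of a Poisson variable with the same mean. Each
  further sample multiplies the moment by the mean of \<open>w\<close>, and
  \<open>1 + x \<le> exp x\<close> bounds that mean.\<close>

lemma nn_integral_exp_count_list:
  "(\<integral>\<^sup>+xs. ennreal (exp (s * real (count_list xs i))) \<partial>replicate_pmf n P)
     \<le> ennreal (exp (real n * pmf P i * (exp s - 1)))"
proof (induction n)
  case 0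
  show ?case by simp
next
  case (Suc n)
  define w where "w x = 1 + (exp s - 1) * indicator {i} x" for x
  have w: "0 \<le> w x" for x
    by (simp add: w_def indicator_def)
  have count: "exp (s * real (count_list (x # xs) i)) = w x * exp (s * real (count_list xs i))" for x xs
    by (auto simp: w_def indicator_def algebra_simps simp flip: exp_add)
  have "integral\<^sup>L P w = 1 + (exp s - 1) * pmf P i"
    unfolding w_def by (subst Bochner_Integration.integral_add)
      (auto simp: integrable_real_indicator measure_pmf.emeasure_eq_measure measure_pmf_single)
  also have "\<dots> \<le> exp (pmf P i * (exp s - 1))"
    using exp_ge_add_one_self[of "pmf P i * (exp s - 1)"] by (simp add: algebra_simps)
  finally have "integral\<^sup>L P w \<le> exp (pmf P i * (exp s - 1))" .
  moreover have "integrable P w"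
    unfolding w_def by (auto simp: integrable_real_indicator measure_pmf.emeasure_eq_measure)
  ultimately have step: "(\<integral>\<^sup>+x. ennreal (w x) \<partial>P) \<le> ennreal (exp (pmf P i * (exp s - 1)))"
    by (subst nn_integral_eq_integral) (auto simp: w intro!: ennreal_leI)
  have "(\<integral>\<^sup>+xs. ennreal (exp (s * real (count_list xs i))) \<partial>replicate_pmf (Suc n) P)
      = (\<integral>\<^sup>+x. \<integral>\<^sup>+xs. ennreal (w x) * ennreal (exp (s * real (count_list xs i)))
            \<partial>replicate_pmf n P \<partial>P)"
    by (simp add: count w ennreal_mult del: count_list.simps)
  also have "\<dots> = (\<integral>\<^sup>+x. ennreal (w x) \<partial>P) *
      (\<integral>\<^sup>+xs. ennreal (exp (s * real (count_list xs i))) \<partial>replicate_pmf n P)"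
    by (simp add: nn_integral_cmult nn_integral_multc)
  also have "\<dots> \<le> ennreal (exp (pmf P i * (exp s - 1))) *
      ennreal (exp (real n * pmf P i * (exp s - 1)))"
    by (intro mult_mono step Suc.IH) auto
  also have "\<dots> = ennreal (exp (real (Suc n) * pmf P i * (exp s - 1)))"
    by (simp add: algebra_simps flip: ennreal_mult exp_add)
  finally show ?case .
qed

text \<open>Markov's inequality for \<open>exp (s * real (count_list xs i))\<close>; leaving the
  sign of \<open>s\<close> free serves both tails.\<close>

lemma prob_count_list_exponential_bound:
  assumes "\<bar>s\<bar> \<le> 1" and b: "\<And>xs. xs \<in> A \<Longrightarrow> b \<le> s * real (count_list xs i)"
  shows "measure_pmf.prob (replicate_pmf n P) A \<le> exp (real n * pmf P i * (s + s\<^sup>2) - b)"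
proof -
  let ?R = "replicate_pmf n P" and ?m = "real n * pmf P i"
  have "emeasure ?R A = (\<integral>\<^sup>+xs. indicator A xs \<partial>?R)"
    by simp
  also have "\<dots> \<le> (\<integral>\<^sup>+xs. ennreal (exp (- b)) * ennreal (exp (s * real (count_list xs i))) \<partial>?R)"
    using b by (intro nn_integral_mono) (auto simp: indicator_def simp flip: ennreal_mult exp_add)
  also have "\<dots> = ennreal (exp (- b)) * (\<integral>\<^sup>+xs. ennreal (exp (s * real (count_list xs i))) \<partial>?R)"
    by (simp add: nn_integral_cmult)
  also have "\<dots> \<le> ennreal (exp (- b)) * ennreal (exp (?m * (exp s - 1)))"
    by (intro mult_left_mono nn_integral_exp_count_list) auto
  also have "\<dots> = ennreal (exp (?m * (exp s - 1) - b))"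
    by (simp flip: ennreal_mult exp_add)
  also have "\<dots> \<le> ennreal (exp (?m * (s + s\<^sup>2) - b))"
    using exp_le_quadratic[OF assms(1)] by (intro ennreal_leI) (auto intro!: mult_left_mono)
  finally show ?thesis
    by (simp add: measure_pmf.emeasure_eq_measure)
qed

lemma prob_count_list_ge:
  fixes n :: nat and P :: "'a pmf" and i :: 'a and t :: real
  defines "M \<equiv> real n * pmf P i"
  assumes "0 \<le> t"
  shows "measure_pmf.prob (replicate_pmf n P) {xs. M + t \<le> real (count_list xs i)}
           \<le> exp (- (t\<^sup>2 / (4 * (M + t))))"
\<comment> \<open>If \<open>M + t = 0\<close>, division by zero makes the exponent 0 and the bound
  1.\<close>
proof (cases "M + t = 0")
  case False
  have M: "0 \<le> M" "M + t > 0"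
    using False \<open>0 \<le> t\<close> by (auto simp: M_def order_less_le)
  \<comment> \<open>The minimiser of \<open>(M + t) * s\<^sup>2 - s * t\<close>, the exponent after
    enlarging \<open>M\<close> to \<open>M + t\<close> in the quadratic term; it stays below 1 even
    when \<open>t\<close> is far larger than \<open>M\<close>.\<close>
  define s where "s = t / (2 * (M + t))"
  have s: "0 \<le> s" "s \<le> 1"
    using M \<open>0 \<le> t\<close> by (simp_all add: s_def divide_le_eq)
  have "measure_pmf.prob (replicate_pmf n P) {xs. M + t \<le> real (count_list xs i)}
      \<le> exp (M * (s + s\<^sup>2) - s * (M + t))"
    using prob_count_list_exponential_bound[of s "{xs. M + t \<le> real (count_list xs i)}" "s * (M + t)" i n P] s
    by (auto simp: M_def mult_left_mono)
  also have "M * (s + s\<^sup>2) - s * (M + t) \<le> (M + t) * s\<^sup>2 - s * t"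
    using assms by (simp add: algebra_simps)
  also have "\<dots> = - (t\<^sup>2 / (4 * (M + t)))"
  proof -
    have "D * (t / (2 * D))\<^sup>2 = t\<^sup>2 / (4 * D)" for D
      by (simp add: power2_eq_square)
    then have "(M + t) * s\<^sup>2 = t\<^sup>2 / (4 * (M + t))"
      unfolding s_def .
    moreover have "t / (2 * D) * t = 2 * (t\<^sup>2 / (4 * D))" for D
      by (simp add: power2_eq_square)
    then have "s * t = 2 * (t\<^sup>2 / (4 * (M + t)))"
      unfolding s_def .
    ultimately show ?thesis by linarith
  qed
  finally show ?thesis by simp
qed simp

lemma prob_count_list_le:
  fixes n :: nat and P :: "'a pmf" and i :: 'a and t :: real
  defines "M \<equiv> real n * pmf P i"
  assumes "0 \<le> t" "t \<le> M"
  shows "measure_pmf.prob (replicate_pmf n P) {xs. real (count_list xs i) \<le> M - t}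
           \<le> exp (- (t\<^sup>2 / (4 * M)))"
proof (cases "M = 0")
  case False
  moreover have "0 \<le> M"
    by (simp add: M_def)
  ultimately have M: "0 < M" "t \<le> M"
    using \<open>t \<le> M\<close> by linarith+
  \<comment> \<open>The minimiser of \<open>M * s\<^sup>2 - s * t\<close>; the lower tail uses the
    parameter \<open>- s\<close>.\<close>
  define s where "s = t / (2 * M)"
  have s: "0 \<le> s" "s \<le> 1"
    using M \<open>0 \<le> t\<close> by (simp_all add: s_def divide_le_eq)
  have "measure_pmf.prob (replicate_pmf n P) {xs. real (count_list xs i) \<le> M - t}
      \<le> exp (M * (- s + (- s)\<^sup>2) - (- s) * (M - t))"
    using prob_count_list_exponential_bound[of "- s" "{xs. real (count_list xs i) \<le> M - t}" "- s * (M - t)" i n P] s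
    by (auto simp: M_def mult_left_mono)
  also have "M * (- s + (- s)\<^sup>2) - (- s) * (M - t) = - (t\<^sup>2 / (4 * M))"
  proof -
    have "M * s\<^sup>2 = t\<^sup>2 / (4 * M)"
      using M by (simp add: s_def power_divide power2_eq_square)
    moreover have "s * t = 2 * (t\<^sup>2 / (4 * M))" "s * M = t / 2"
      using M by (simp_all add: s_def power2_eq_square)
    ultimately show ?thesis by (simp add: algebra_simps)
  qed
  finally show ?thesis by simp
qed simp

text \<open>The event is determined by an integer count, so it suffices to apply the tail bound at
  the extremal count in the event.\<close>

lemma prob_count_list_upper_deviation:
  assumes "0 \<le> T"
  shows "measure_pmf.prob (replicate_pmf n P)
           {xs. real n * pmf P i < real (count_list xs i) \<and>
                4 * T * real (count_list xs i) < (real (count_list xs i) - real n * pmf P i)\<^sup>2}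
         \<le> exp (- T)"
proof -
  define m where "m = real n * pmf P i"
  define B where "B = {c::nat. m < c \<and> 4 * T * c < (real c - m)\<^sup>2}"
  have m0: "0 \<le> m" by (simp add: m_def)
  have "measure_pmf.prob (replicate_pmf n P) {xs. count_list xs i \<in> B} \<le> exp (- T)"
  proof (cases "B = {}")
    case False
    define c where "c = (LEAST c. c \<in> B)"
    have "c \<in> B"
      unfolding c_def using False by (auto intro: LeastI)
    then have c: "m < c" "4 * T * c < (real c - m)\<^sup>2"
      by (auto simp: B_def)
    have "measure_pmf.prob (replicate_pmf n P) {xs. count_list xs i \<in> B}
        \<le> measure_pmf.prob (replicate_pmf n P) {xs. m + (real c - m) \<le> real (count_list xs i)}"
      by (intro measure_pmf.finite_measure_mono) (auto simp: c_def intro: Least_le)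
    also have "\<dots> \<le> exp (- ((real c - m)\<^sup>2 / (4 * c)))"
      using prob_count_list_ge[of "real c - m" n P i] c by (simp add: m_def)
    also have "\<dots> \<le> exp (- T)"
      using c m0 by (simp add: field_simps)
    finally show ?thesis .
  qed simp
  then show ?thesis by (simp add: B_def m_def)
qed

text \<open>The mean replaces the count as normaliser because the lower tail exponent has
  denominator \<open>4 * M\<close>, whereas the upper one has \<open>4 * (M + t)\<close>, with
  \<open>M + t\<close> the count itself. Counts below the mean are bounded, so the extremal one is a
  maximum.\<close>

lemma prob_count_list_lower_deviation:
  assumes "0 \<le> T"
  shows "measure_pmf.prob (replicate_pmf n P)
           {xs. real (count_list xs i) < real n * pmf P i \<and>
                4 * T * (real n * pmf P i) < (real n * pmf P i - real (count_list xs i))\<^sup>2}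
         \<le> exp (- T)"
proof -
  define m where "m = real n * pmf P i"
  define B where "B = {c::nat. c < m \<and> 4 * T * m < (m - real c)\<^sup>2}"
  have "B \<subseteq> {..nat \<lceil>m\<rceil>}"
    by (auto simp: B_def) linarith
  then have fin: "finite B"
    using finite_subset by blast
  have "measure_pmf.prob (replicate_pmf n P) {xs. count_list xs i \<in> B} \<le> exp (- T)"
  proof (cases "B = {}")
    case False
    define c where "c = Max B"
    have "c \<in> B"
      unfolding c_def using False fin by simp
    then have c: "c < m" "4 * T * m < (m - real c)\<^sup>2"
      by (auto simp: B_def)
    have "measure_pmf.prob (replicate_pmf n P) {xs. count_list xs i \<in> B}
        \<le> measure_pmf.prob (replicate_pmf n P) {xs. real (count_list xs i) \<le> m - (m - real c)}"
      using fin by (intro measure_pmf.finite_measure_mono) (auto simp: c_def)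
    also have "\<dots> \<le> exp (- ((m - real c)\<^sup>2 / (4 * m)))"
      using prob_count_list_le[of "m - real c" n P i] c by (simp add: m_def)
    also have "\<dots> \<le> exp (- T)"
      using c by (simp add: field_simps)
    finally show ?thesis .
  qed simp
  then show ?thesis by (simp add: B_def m_def)
qed

section \<open>Expected contribution of undersampled symbols\<close>

lemma power2_mult_exp_minus_le:
  fixes m a :: real
  assumes "0 \<le> m" "a \<le> m"
  shows "m\<^sup>2 * exp (- (m / 16)) \<le> 2048 * exp (- (a / 32))"
proof -
  \<comment> \<open>From \<open>x\<^sup>2 / 2 \<le> exp x\<close> at \<open>x = m / 32\<close>, so
    \<open>2048 = 2 * 32\<^sup>2\<close>. Half of the decay pays for \<open>m\<^sup>2\<close>, the
    other half is kept.\<close>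
  have "m\<^sup>2 / 2048 \<le> exp (m / 32)"
    using exp_lower_Taylor_quadratic[of "m / 32"] assms by (simp add: power2_eq_square field_simps)
  then have "m\<^sup>2 * exp (- (m / 16)) \<le> 2048 * exp (m / 32) * exp (- (m / 16))"
    by (intro mult_right_mono) auto
  also have "\<dots> = 2048 * exp (- (m / 32))"
    by (simp flip: exp_add)
  also have "\<dots> \<le> 2048 * exp (- (a / 32))"
    using assms by simp
  finally show ?thesis .
qed

text \<open>The tail bound at half the mean gives each symbol of \<open>S\<close> an expected
  contribution of at most \<open>2048 * \<delta>\<close>; linearity of expectation copes with the
  dependence between counts. Excluding the events by a union bound instead would force
  \<open>a\<close> to grow with the logarithm of the alphabet size.\<close>

lemma prob_undersampled_mass_ge:
  fixes \<Sigma> :: "'a set" and P :: "'a pmf" and n :: nat and a \<delta> t :: real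
  defines "m \<equiv> \<lambda>i. real n * pmf P i"
  defines "S \<equiv> {i\<in>\<Sigma>. a < m i}"
  assumes "finite \<Sigma>" and a: "exp (- (a / 32)) \<le> \<delta>" and t: "0 < t"
  shows "measure_pmf.prob (replicate_pmf n P)
           {xs. t \<le> (\<Sum>i\<in>S. (m i)\<^sup>2 * of_bool (2 * real (count_list xs i) < m i))}
         \<le> 2048 * real (card \<Sigma>) * \<delta> / t"
proof -
  define R where "R = measure_pmf (replicate_pmf n P)"
  define E where "E i = {xs. 2 * real (count_list xs i) < m i}" for i
  define Y where "Y xs = (\<Sum>i\<in>S. (m i)\<^sup>2 * indicator (E i) xs)" for xs
  have m0: "0 \<le> m i" for i
    by (simp add: m_def)
  have int: "integrable R (\<lambda>xs. (m i)\<^sup>2 * indicator (E i) xs)" for i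
    by (auto simp: R_def integrable_real_indicator measure_pmf.emeasure_eq_measure)
  have "finite S" "S \<subseteq> \<Sigma>"
    using assms by (auto simp: S_def)
  have summand: "(m i)\<^sup>2 * measure R (E i) \<le> 2048 * \<delta>" if "i \<in> S" for i
  proof -
    have "measure R (E i) \<le> measure R {xs. real (count_list xs i) \<le> m i - m i / 2}"
      unfolding R_def by (intro measure_pmf.finite_measure_mono) (auto simp: E_def)
    also have "\<dots> \<le> exp (- (m i / 16))"
    proof -
      have "(real n * pmf P i / 2)\<^sup>2 / (4 * (real n * pmf P i)) = real n * pmf P i / 16"
        by (simp add: power2_eq_square)
      with prob_count_list_le[of "m i / 2" n P i] m0[of i] show ?thesis
        unfolding m_def R_def by simp
    qed
    finally have "(m i)\<^sup>2 * measure R (E i) \<le> (m i)\<^sup>2 * exp (- (m i / 16))"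
      by (intro mult_left_mono) auto
    also have "\<dots> \<le> 2048 * exp (- (a / 32))"
      using that m0 by (intro power2_mult_exp_minus_le) (auto simp: S_def)
    finally show ?thesis using a by linarith
  qed
  have "integral\<^sup>L R Y = (\<Sum>i\<in>S. (m i)\<^sup>2 * measure R (E i))"
    unfolding Y_def using int by (subst Bochner_Integration.integral_sum) (auto simp: R_def)
  also have "\<dots> \<le> real (card S) * (2048 * \<delta>)"
    using summand by (rule sum_bounded_above)
  also have "\<dots> \<le> real (card \<Sigma>) * (2048 * \<delta>)"
    using \<open>S \<subseteq> \<Sigma>\<close> assms order_trans[OF exp_ge_zero a]
    by (intro mult_right_mono) (auto intro: card_mono)
  finally have "integral\<^sup>L R Y \<le> 2048 * real (card \<Sigma>) * \<delta>"
    by simp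
  moreover have "measure R {xs\<in>space R. t \<le> Y xs} \<le> integral\<^sup>L R Y / t"
    using int t by (intro integral_Markov_inequality_measure[where A = "{}"])
      (auto simp: Y_def intro!: sum_nonneg)
  ultimately have "measure R {xs\<in>space R. t \<le> Y xs} \<le> 2048 * real (card \<Sigma>) * \<delta> / t"
    using t by (smt (verit) divide_right_mono)
  moreover have "of_bool (2 * real (count_list xs i) < m i) = (indicator (E i) xs :: real)" for xs i
    by (simp add: E_def indicator_def)
  ultimately show ?thesis
    by (simp add: R_def Y_def)
qed

section \<open>Deterministic bounds for one term of the divergence\<close>

text \<open>Outside both tail events, a count of at least half the mean yields a term of order
  \<open>T\<close>. A smaller count yields only \<open>m\<^sup>2 / K\<close>, charged to
  \<open>a\<^sup>2 / K\<close> or to the random sum handled by Markov's inequality. The second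
  inequality serves the smoothing bias.\<close>

lemma count_deviation_le:
  fixes m c K T a :: real
  assumes "0 \<le> c" "0 \<le> m" "0 < K" "0 \<le> T" "0 \<le> a"
    and upper: "\<not> (m < c \<and> 4 * T * c < (c - m)\<^sup>2)"
    and lower: "\<not> (c < m \<and> 4 * T * m < (m - c)\<^sup>2)"
  shows "(m - c)\<^sup>2 / (c + K) \<le> 8 * T + a\<^sup>2 / K + of_bool (a < m) * (m\<^sup>2 * of_bool (2 * c < m)) / K"
    and "m \<le> 2 * c + 16 * T"
proof -
  consider "m \<le> c" | "c < m" "m \<le> 2 * c" | "2 * c < m" by linarith
  then have "(m - c)\<^sup>2 / (c + K) \<le> 8 * T + a\<^sup>2 / K + of_bool (a < m) * (m\<^sup>2 * of_bool (2 * c < m)) / K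
      \<and> m \<le> 2 * c + 16 * T"
  proof cases
    case 1
    then have "(m - c)\<^sup>2 \<le> 4 * T * c"
      using upper assms by (cases "m = c") (auto simp: power2_commute)
    also have "\<dots> \<le> 8 * T * (c + K)"
      using assms by (simp add: algebra_simps)
    finally have "(m - c)\<^sup>2 / (c + K) \<le> 8 * T"
      using assms by (simp add: field_simps)
    moreover have "0 \<le> a\<^sup>2 / K" "0 \<le> of_bool (a < m) * (m\<^sup>2 * of_bool (2 * c < m)) / K"
      using assms by auto
    ultimately show ?thesis using 1 assms by linarith
  next
    case 2
    then have "(m - c)\<^sup>2 \<le> 4 * T * m"
      using lower by linarith
    also have "\<dots> \<le> 4 * T * (2 * (c + K))"
      using assms 2 by (intro mult_left_mono) auto
    finally have "(m - c)\<^sup>2 / (c + K) \<le> 8 * T"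
      using assms by (simp add: field_simps)
    moreover have "0 \<le> a\<^sup>2 / K" "0 \<le> of_bool (a < m) * (m\<^sup>2 * of_bool (2 * c < m)) / K"
      using assms by auto
    ultimately show ?thesis using 2 assms by linarith
  next
    case 3
    have "(m / 2)\<^sup>2 \<le> (m - c)\<^sup>2"
      using 3 assms by (intro power_mono) auto
    also have "\<dots> \<le> 4 * T * m"
      using lower 3 assms by linarith
    finally have "m * m \<le> 16 * T * m"
      by (simp add: power2_eq_square)
    then have "m \<le> 16 * T"
      using 3 assms by (auto dest: mult_right_le_imp_le)
    \<comment> \<open>Inserting \<open>m \<le> 16 * T\<close> here would give
      \<open>256 * T\<^sup>2 / K\<close>, too large when \<open>T\<close> far exceeds
      \<open>K\<close>; hence the split at \<open>a\<close>.\<close>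
    have "(m - c)\<^sup>2 / (c + K) \<le> m\<^sup>2 / K"
      using 3 assms by (intro frac_le power_mono) auto
    also have "\<dots> \<le> a\<^sup>2 / K + of_bool (a < m) * (m\<^sup>2 * of_bool (2 * c < m)) / K"
      using 3 assms by (auto simp: not_less intro!: divide_right_mono power_mono)
    finally show ?thesis using \<open>m \<le> 16 * T\<close> assms by linarith
  qed
  then show "(m - c)\<^sup>2 / (c + K) \<le> 8 * T + a\<^sup>2 / K + of_bool (a < m) * (m\<^sup>2 * of_bool (2 * c < m)) / K"
    and "m \<le> 2 * c + 16 * T" by auto
qed

text \<open>Over the common denominator, the error splits into the sampling deviation
  \<open>n * p - c\<close> and the smoothing bias \<open>K * (k * p - 1)\<close>.\<close>

lemma add_K_chi2_term_le:
  fixes n k K p c T :: real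
  assumes "0 < n" "0 < k" "0 < K" "0 \<le> p" "0 \<le> c" "0 \<le> T"
    and m: "n * p \<le> 2 * c + 16 * T"
  defines "Q \<equiv> (c + K) / (n + K * k)"
  shows "(p - Q)\<^sup>2 / Q \<le> 2 / n * ((n * p - c)\<^sup>2 / (c + K) + K + p * k * (2 * K + 16 * T))"
proof -
  define D where "D = n + K * k"
  have pos: "0 < D" "n \<le> D" "K * k \<le> D" "0 < c + K"
    using assms by (auto simp: D_def add_pos_pos)
  have "(n * p - c + K * (k * p - 1))\<^sup>2 \<le> 2 * (n * p - c)\<^sup>2 + 2 * (K * (k * p - 1))\<^sup>2"
    using sum_squares_ge_zero[of "n * p - c - K * (k * p - 1)" 0]
    by (simp add: power2_eq_square algebra_simps)
  also have "(K * (k * p - 1))\<^sup>2 \<le> K\<^sup>2 + (K * k * p)\<^sup>2"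
    using assms by (simp add: power2_eq_square algebra_simps)
  finally have num: "(n * p - c + K * (k * p - 1))\<^sup>2 \<le> 2 * ((n * p - c)\<^sup>2 + K\<^sup>2 + (K * k * p)\<^sup>2)"
    by simp
  have "(p - Q)\<^sup>2 / Q = (n * p - c + K * (k * p - 1))\<^sup>2 / (D * (c + K))"
  proof -
    have "p - Q = (n * p - c + K * (k * p - 1)) / D"
      using pos by (simp add: Q_def field_simps flip: D_def) (simp add: D_def algebra_simps)
    then show ?thesis
      using pos by (simp add: Q_def power_divide power2_eq_square flip: D_def)
  qed
  also have "\<dots> \<le> 2 * ((n * p - c)\<^sup>2 + K\<^sup>2 + (K * k * p)\<^sup>2) / (D * (c + K))"
    using num pos by (intro divide_right_mono) auto
  also have "\<dots> = 2 * ((n * p - c)\<^sup>2 / (D * (c + K)) + K\<^sup>2 / (D * (c + K)) + (K * k * p)\<^sup>2 / (D * (c + K)))"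
    by (simp add: add_divide_distrib)
  also have "\<dots> \<le> 2 * ((n * p - c)\<^sup>2 / (c + K) / n + K / n + p * k * (2 * K + 16 * T) / n)"
  proof (intro mult_left_mono add_mono)
    show "(n * p - c)\<^sup>2 / (D * (c + K)) \<le> (n * p - c)\<^sup>2 / (c + K) / n"
      using assms pos by (simp add: mult.commute) (intro divide_left_mono mult_right_mono mult_pos_pos; simp)
    have "K\<^sup>2 / (D * (c + K)) \<le> K\<^sup>2 / (n * K)"
      using assms pos by (intro divide_left_mono mult_mono mult_pos_pos) auto
    then show "K\<^sup>2 / (D * (c + K)) \<le> K / n"
      using assms by (simp add: power2_eq_square)
    have "(n * p) * K \<le> (2 * c + 16 * T) * K"
      using m assms by (intro mult_right_mono) auto
    also have "\<dots> \<le> (2 * K + 16 * T) * (c + K)"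
      using assms by (simp add: algebra_simps)
    finally have *: "n * p * K \<le> (2 * K + 16 * T) * (c + K)" .
    \<comment> \<open>Bounding \<open>D\<close> below by \<open>K * k\<close> instead of
      \<open>n\<close> cancels one factor \<open>K * k\<close>. The inequality \<open>*\<close> then
      removes one factor \<open>p\<close>, leaving a term linear in \<open>p\<close>.\<close>
    have "(K * k * p)\<^sup>2 / (D * (c + K)) \<le> (K * k * p)\<^sup>2 / (K * k * (c + K))"
      using assms pos by (intro divide_left_mono mult_mono mult_pos_pos) auto
    also have "\<dots> = p * k * (n * p * K) / (n * (c + K))"
    proof -
      have "(K * k * p)\<^sup>2 / (K * k * G) = p * k * (n * p * K) / (n * G)" for G
        using assms by (simp add: power2_eq_square)
      then show ?thesis .
    qed
    also have "\<dots> \<le> p * k * ((2 * K + 16 * T) * (c + K)) / (n * (c + K))"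
      using * assms pos by (intro divide_right_mono mult_left_mono) auto
    also have "\<dots> = p * k * (2 * K + 16 * T) / n"
      using pos by simp
    finally show "(K * k * p)\<^sup>2 / (D * (c + K)) \<le> p * k * (2 * K + 16 * T) / n" .
  qed auto
  also have "\<dots> = 2 / n * ((n * p - c)\<^sup>2 / (c + K) + K + p * k * (2 * K + 16 * T))"
    by (simp only: add_divide_distrib[symmetric] times_divide_eq_right times_divide_eq_left)
  finally show ?thesis .
qed

section \<open>The good event and the bound with explicit constants\<close>

text \<open>Upper tails, lower tails and undersampled mass each get failure probability
  \<open>\<delta> / 3\<close>. The threshold \<open>a\<close> stays free; a suitable multiple of
  \<open>K\<close> will make \<open>a\<^sup>2 / K\<close> of order \<open>K\<close>.\<close>

lemma add_K_success_prob_explicit: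
  fixes \<Sigma> :: "'a set" and P :: "'a pmf" and N :: nat and K \<delta> a :: real
  assumes fin: "finite \<Sigma>" and supp: "set_pmf P \<subseteq> \<Sigma>" and N: "1 \<le> N"
    and K: "0 < K" and \<delta>: "0 < \<delta>" "\<delta> \<le> 1" and a: "0 \<le> a" "exp (- (a / 32)) \<le> \<delta>"
  shows "1 - \<delta> \<le> add_K_success_prob \<Sigma> P N K
    (2 * real (card \<Sigma>) / real N * (24 * ln (3 * real (card \<Sigma>) / \<delta>) + 3 * K + (a\<^sup>2 + 6144) / K))"
    (is "_ \<le> add_K_success_prob _ _ _ _ ?r")
proof -
  define k where "k = real (card \<Sigma>)"
  \<comment> \<open>Chosen so that a union bound over the \<open>k\<close> symbols costs
    \<open>\<delta> / 3\<close> per tail.\<close>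
  define T where "T = ln (3 * k / \<delta>)"
  define R where "R = measure_pmf (replicate_pmf N P)"
  define m where "m i = real N * pmf P i" for i
  define c where "c i xs = real (count_list xs i)" for i :: 'a and xs
  define S where "S = {i\<in>\<Sigma>. a < m i}"
  define U where "U i = {xs. m i < c i xs \<and> 4 * T * c i xs < (c i xs - m i)\<^sup>2}" for i
  define V where "V i = {xs. c i xs < m i \<and> 4 * T * m i < (m i - c i xs)\<^sup>2}" for i
  \<comment> \<open>Since \<open>6144 = 3 * 2048\<close>, Markov's inequality costs
    \<open>\<delta> / 3\<close>.\<close>
  define W where "W = {xs. 6144 * k \<le> (\<Sum>i\<in>S. (m i)\<^sup>2 * of_bool (2 * c i xs < m i))}"
  define B where "B = (\<Union>i\<in>\<Sigma>. U i) \<union> (\<Union>i\<in>\<Sigma>. V i) \<union> W"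
  have "\<Sigma> \<noteq> {}"
    using supp set_pmf_not_empty[of P] by auto
  then have k: "1 \<le> k"
    using fin by (simp add: k_def Suc_le_eq card_gt_0_iff)
  then have T: "0 \<le> T" "k * exp (- T) = \<delta> / 3"
    using \<delta> by (simp_all add: T_def exp_minus)
  have "measure R (\<Union>i\<in>\<Sigma>. U i) \<le> (\<Sum>i\<in>\<Sigma>. measure R (U i))"
    unfolding R_def using fin by (intro measure_pmf.finite_measure_subadditive_finite) auto
  also have "\<dots> \<le> k * exp (- T)"
    unfolding k_def R_def U_def c_def m_def
    using prob_count_list_upper_deviation[OF T(1)] by (intro sum_bounded_above)
  finally have PU: "measure R (\<Union>i\<in>\<Sigma>. U i) \<le> \<delta> / 3"
    using T by simp
  have "measure R (\<Union>i\<in>\<Sigma>. V i) \<le> (\<Sum>i\<in>\<Sigma>. measure R (V i))"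
    unfolding R_def using fin by (intro measure_pmf.finite_measure_subadditive_finite) auto
  also have "\<dots> \<le> k * exp (- T)"
    unfolding k_def R_def V_def c_def m_def
    using prob_count_list_lower_deviation[OF T(1)] by (intro sum_bounded_above)
  finally have PV: "measure R (\<Union>i\<in>\<Sigma>. V i) \<le> \<delta> / 3"
    using T by simp
  have "measure R W \<le> 2048 * k * \<delta> / (6144 * k)"
    using prob_undersampled_mass_ge[OF fin a(2), of "6144 * k" N P] k
    by (simp add: W_def R_def S_def m_def c_def k_def)
  then have PW: "measure R W \<le> \<delta> / 3"
    using k by simp
  have "measure R B \<le> measure R ((\<Union>i\<in>\<Sigma>. U i) \<union> (\<Union>i\<in>\<Sigma>. V i)) + measure R W"
    unfolding B_def R_def by (intro measure_Un_le) auto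
  also have "measure R ((\<Union>i\<in>\<Sigma>. U i) \<union> (\<Union>i\<in>\<Sigma>. V i))
      \<le> measure R (\<Union>i\<in>\<Sigma>. U i) + measure R (\<Union>i\<in>\<Sigma>. V i)"
    unfolding R_def by (intro measure_Un_le) auto
  finally have PB: "measure R B \<le> \<delta>"
    using PU PV PW by linarith
  have good: "chi2_div \<Sigma> (pmf P) (add_K_estimator \<Sigma> K xs) \<le> ?r" if len: "length xs = N" and xs: "xs \<notin> B" for xs
  proof -
    have nonneg: "0 \<le> c i xs" "0 \<le> m i" for i
      by (simp_all add: c_def m_def)
    have undersampled: "(\<Sum>i\<in>\<Sigma>. of_bool (a < m i) * ((m i)\<^sup>2 * of_bool (2 * c i xs < m i)) / K) \<le> 6144 * k / K"
    proof -
      have "(\<Sum>i\<in>\<Sigma>. of_bool (a < m i) * ((m i)\<^sup>2 * of_bool (2 * c i xs < m i)) / K)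
          = (\<Sum>i\<in>S. (m i)\<^sup>2 * of_bool (2 * c i xs < m i)) / K"
        unfolding S_def sum_divide_distrib using fin
        by (subst sum.inter_filter) (auto intro!: sum.cong)
      also have "\<dots> \<le> 6144 * k / K"
        using xs K by (intro divide_right_mono) (auto simp: B_def W_def)
      finally show ?thesis .
    qed
    have "chi2_div \<Sigma> (pmf P) (add_K_estimator \<Sigma> K xs)
        \<le> (\<Sum>i\<in>\<Sigma>. 2 / real N * (8 * T + a\<^sup>2 / K
              + of_bool (a < m i) * ((m i)\<^sup>2 * of_bool (2 * c i xs < m i)) / K
              + K + pmf P i * k * (2 * K + 16 * T)))"
      unfolding chi2_div_def
    proof (rule sum_mono)
      fix i assume i: "i \<in> \<Sigma>"
      let ?Q = "add_K_estimator \<Sigma> K xs i"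
      have dev: "(m i - c i xs)\<^sup>2 / (c i xs + K)
          \<le> 8 * T + a\<^sup>2 / K + of_bool (a < m i) * ((m i)\<^sup>2 * of_bool (2 * c i xs < m i)) / K"
        and m: "m i \<le> 2 * c i xs + 16 * T"
        using xs i count_deviation_le[OF nonneg[of i] K T(1) a(1)] by (auto simp: B_def U_def V_def)
      have "(pmf P i - ?Q)\<^sup>2 / ?Q \<le> 2 / real N *
          ((m i - c i xs)\<^sup>2 / (c i xs + K) + K + pmf P i * k * (2 * K + 16 * T))"
        using add_K_chi2_term_le[of "real N" k K "pmf P i" "c i xs" T] N k K T m nonneg
        by (simp add: add_K_estimator_def len c_def m_def k_def)
      also have "\<dots> \<le> 2 / real N * (8 * T + a\<^sup>2 / K
              + of_bool (a < m i) * ((m i)\<^sup>2 * of_bool (2 * c i xs < m i)) / K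
              + K + pmf P i * k * (2 * K + 16 * T))"
        using dev by (intro mult_left_mono add_right_mono) auto
      finally show "(pmf P i - ?Q)\<^sup>2 / ?Q \<le> \<dots>" .
    qed
    also have "\<dots> = 2 / real N * (k * (8 * T + a\<^sup>2 / K)
        + (\<Sum>i\<in>\<Sigma>. of_bool (a < m i) * ((m i)\<^sup>2 * of_bool (2 * c i xs < m i)) / K)
        + k * K + (\<Sum>i\<in>\<Sigma>. pmf P i) * (k * (2 * K + 16 * T)))"
      unfolding sum_distrib_left[symmetric] sum.distrib sum_distrib_right[symmetric] sum_constant k_def[symmetric]
      by (simp add: algebra_simps)
    \<comment> \<open>The bias terms weighted by \<open>pmf P i\<close> thus add up to a multiple of
      \<open>k\<close>, not of \<open>k\<^sup>2\<close>.\<close>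
    also have "(\<Sum>i\<in>\<Sigma>. pmf P i) = 1"
      using fin supp by (rule sum_pmf_eq_1)
    also have "2 / real N * (k * (8 * T + a\<^sup>2 / K)
        + (\<Sum>i\<in>\<Sigma>. of_bool (a < m i) * ((m i)\<^sup>2 * of_bool (2 * c i xs < m i)) / K)
        + k * K + 1 * (k * (2 * K + 16 * T)))
      \<le> 2 / real N * (k * (8 * T + a\<^sup>2 / K) + 6144 * k / K + k * K + 1 * (k * (2 * K + 16 * T)))"
      using undersampled by (intro mult_left_mono add_right_mono add_left_mono) auto
    also have "\<dots> = 2 * k / real N * (24 * T + 3 * K + (a\<^sup>2 + 6144) / K)"
      by (simp add: algebra_simps add_divide_distrib)
    finally show ?thesis
      by (simp add: k_def T_def)
  qed
  have "1 - \<delta> \<le> measure R (space R - B)"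
    using PB measure_pmf.prob_compl[of B "replicate_pmf N P"] by (simp add: R_def)
  \<comment> \<open>Passing to the support leaves only lists of length \<open>N\<close>, as
    \<open>good\<close> requires.\<close>
  also have "\<dots> = measure R ((space R - B) \<inter> set_pmf (replicate_pmf N P))"
    unfolding R_def by (simp add: measure_Int_set_pmf)
  also have "\<dots> \<le> add_K_success_prob \<Sigma> P N K ?r"
    unfolding add_K_success_prob_def R_def
    by (intro measure_pmf.finite_measure_mono) (use good in \<open>force simp: set_replicate_pmf\<close>)+
  finally show ?thesis .
qed

section \<open>From explicit constants to the growth condition on \<open>K\<close>\<close>

lemma add_K_success_prob_mono:
  "r \<le> r' \<Longrightarrow> add_K_success_prob \<Sigma> P N K r \<le> add_K_success_prob \<Sigma> P N K r'"
  unfolding add_K_success_prob_def by (intro measure_pmf.finite_measure_mono) auto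

text \<open>With one symbol and \<open>\<delta> = 1\<close> the claimed bound is 0, so the estimate
  must be exact. It is \<open>(N + K) / (N + K) = 1\<close>, and \<open>K > 0\<close> covers
  \<open>N = 0\<close>.\<close>

lemma add_K_success_prob_singleton:
  assumes "set_pmf P \<subseteq> {x}" "0 < K" "0 \<le> r"
  shows "add_K_success_prob {x} P N K r = 1"
proof -
  have "set_pmf P = {x}"
    using assms set_pmf_not_empty[of P] by auto
  then have P: "pmf P x = 1"
    using set_pmf_subset_singleton[of P x] by simp
  have "chi2_div {x} (pmf P) (add_K_estimator {x} K xs) \<le> r"
    if "xs \<in> set_pmf (replicate_pmf N P)" for xs
  proof -
    have "set xs \<subseteq> {x}"
      using that assms by (auto simp: set_replicate_pmf)
    then have "count_list xs x = length xs"
      by (induction xs) auto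
    then show ?thesis
      using assms P by (simp add: chi2_div_def add_K_estimator_def)
  qed
  then show ?thesis
    unfolding add_K_success_prob_def by (subst measure_pmf.prob_eq_1) (auto simp: AE_measure_pmf_iff)
qed

text \<open>Merges the two regimes of \<open>\<delta>\<close>: up to \<open>\<delta>0\<close> the
  logarithm is at least \<open>ln (1 / \<delta>0)\<close>, beyond it at most that. The three bounds
  control \<open>1 / K\<close>, the condition on \<open>a\<close>, and the terms growing with
  \<open>K\<close>. The assumption \<open>1 / 2 \<le> L\<close> absorbs the constant
  \<open>c2\<close> into \<open>2 * c2 * L\<close>.\<close>

lemma Theta_log_inverse_bounds:
  assumes "0 < c1" "0 < c2" "0 < \<delta>0" "\<delta>0 < 1" "0 < \<delta>" "\<delta> \<le> 1"
    and K: "Theta_log_inverse c1 c2 \<delta>0 \<delta> K"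
    and L: "ln (1 / \<delta>) \<le> L" "1 / 2 \<le> L"
  shows "c1 * min 1 (ln (1 / \<delta>0)) \<le> K"
    and "c1 * min 1 (1 / ln (1 / \<delta>0)) * ln (1 / \<delta>) \<le> K"
    and "K \<le> 2 * c2 * L"
proof -
  define l where "l = ln (1 / \<delta>)"
  define l0 where "l0 = ln (1 / \<delta>0)"
  have l: "0 \<le> l" "0 < l0"
    using assms by (simp_all add: l_def l0_def)
  have "c1 * min 1 l0 \<le> K \<and> c1 * (min 1 (1 / l0) * l) \<le> K \<and> K \<le> c2 * (2 * L)"
  proof (cases "\<delta> \<le> \<delta>0")
    case True
    then have "l0 \<le> l"
      using assms by (auto simp: l_def l0_def frac_le)
    then have "min 1 l0 \<le> l" "l \<le> 2 * L"
      using l L by (simp_all flip: l_def)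
    moreover have "min 1 (1 / l0) * l \<le> 1 * l"
      using l by (intro mult_right_mono) auto
    ultimately have "c1 * min 1 l0 \<le> c1 * l" "c1 * (min 1 (1 / l0) * l) \<le> c1 * (1 * l)"
        "c2 * l \<le> c2 * (2 * L)"
      using assms by (auto intro!: mult_left_mono simp del: mult_1_left)
    then show ?thesis
      using K True by (auto simp: Theta_log_inverse_def l_def)
  next
    case False
    then have "l \<le> l0"
      using assms by (auto simp: l_def l0_def frac_le)
    then have "1 / l0 * l \<le> 1"
      using l by simp
    moreover have "min 1 (1 / l0) * l \<le> 1 / l0 * l"
      using l by (intro mult_right_mono) auto
    ultimately have "c1 * (min 1 (1 / l0) * l) \<le> c1 * 1"
      using assms by (intro mult_left_mono) linarith+
    moreover have "c1 * min 1 l0 \<le> c1 * 1" "c2 * 1 \<le> c2 * (2 * L)"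
      using assms by (auto intro!: mult_left_mono)
    ultimately show ?thesis
      using K False by (auto simp: Theta_log_inverse_def)
  qed
  then show "c1 * min 1 (ln (1 / \<delta>0)) \<le> K" "c1 * min 1 (1 / ln (1 / \<delta>0)) * ln (1 / \<delta>) \<le> K"
      "K \<le> 2 * c2 * L"
    by (simp_all add: l_def l0_def mult_ac)
qed

lemma add_K_success_prob_large_alphabet:
  fixes c1 c2 \<delta>0 :: real
  assumes c: "0 < c1" "0 < c2" "0 < \<delta>0" "\<delta>0 < 1"
  defines "C \<equiv> 2 * (72 + (3 + (32 / (c1 * min 1 (1 / ln (1 / \<delta>0))))\<^sup>2) * (2 * c2)
                 + 12288 / (c1 * min 1 (ln (1 / \<delta>0))))"
  assumes \<delta>: "0 < \<delta>" "\<delta> \<le> 1" and K: "Theta_log_inverse c1 c2 \<delta>0 \<delta> K"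
    and "finite \<Sigma>" "set_pmf P \<subseteq> \<Sigma>" "1 \<le> N" "2 \<le> card \<Sigma>"
  shows "1 - \<delta> \<le> add_K_success_prob \<Sigma> P N K
            (C * (real (card \<Sigma>) * ln (real (card \<Sigma>) / \<delta>) / real N))"
proof -
  define k where "k = real (card \<Sigma>)"
  define L where "L = ln (k / \<delta>)"
  define \<kappa> where "\<kappa> = c1 * min 1 (ln (1 / \<delta>0))"
  define \<gamma> where "\<gamma> = c1 * min 1 (1 / ln (1 / \<delta>0))"
  have pos: "0 < \<kappa>" "0 < \<gamma>"
    using c by (simp_all add: \<kappa>_def \<gamma>_def)
  have k: "2 \<le> k"
    using assms by (simp add: k_def)
  have k\<delta>: "2 \<le> k / \<delta>" "1 / \<delta> \<le> k / \<delta>"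
    using \<delta> k by (simp_all add: le_divide_eq divide_right_mono)
  have "ln (1 / \<delta>) \<le> L"
    unfolding L_def using \<delta> k\<delta> by (subst ln_le_cancel_iff) auto
  moreover have "1 / 2 \<le> ln (2 :: real)"
    using ln2_ge_two_thirds by simp
  then have L: "1 / 2 \<le> L"
    unfolding L_def using k\<delta> by (smt (verit) ln_le_cancel_iff)
  ultimately have K: "\<kappa> \<le> K" "\<gamma> * ln (1 / \<delta>) \<le> K" "K \<le> 2 * c2 * L"
    using Theta_log_inverse_bounds[OF c \<delta> K] by (simp_all add: \<kappa>_def \<gamma>_def)
  \<comment> \<open>The threshold is \<open>a = 32 / \<gamma> * K\<close>, a constant multiple of
    \<open>K\<close> large enough because
    \<open>\<gamma> * ln (1 / \<delta>) \<le> K\<close>.\<close>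
  have "exp (- (32 / \<gamma> * K / 32)) \<le> exp (- ln (1 / \<delta>))"
    using K pos by (simp add: pos_le_divide_eq mult.commute)
  also have "\<dots> = \<delta>"
    using \<delta> by (simp add: ln_div)
  finally have a: "exp (- (32 / \<gamma> * K / 32)) \<le> \<delta>" .
  \<comment> \<open>As \<open>k / \<delta> \<ge> 2\<close>, its square exceeds 3; so the factor 3
    inside the logarithm costs only a factor 3 outside.\<close>
  have "3 * (k / \<delta>) \<le> (k / \<delta>) * (k / \<delta>) * (k / \<delta>)"
    using k\<delta> mult_mono[OF k\<delta>(1) k\<delta>(1)] by (intro mult_right_mono) auto
  then have "ln (3 * k / \<delta>) \<le> ln ((k / \<delta>) ^ 3)"
    using k \<delta> by (subst ln_le_cancel_iff) (auto simp: power3_eq_cube)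
  also have "\<dots> = 3 * L"
    using k \<delta> by (simp add: L_def ln_realpow)
  finally have T: "ln (3 * k / \<delta>) \<le> 3 * L" .
  have "24 * ln (3 * k / \<delta>) + 3 * K + ((32 / \<gamma> * K)\<^sup>2 + 6144) / K
      = 24 * ln (3 * k / \<delta>) + (3 + (32 / \<gamma>)\<^sup>2) * K + 6144 / K"
    using K pos by (simp add: power2_eq_square add_divide_distrib algebra_simps)
  \<comment> \<open>The constant 6144 is multiplied by \<open>2 * L \<ge> 1\<close>, so that every
    term is a multiple of \<open>L\<close>; hence 72 and 12288 in \<open>C\<close>.\<close>
  also have "\<dots> \<le> 24 * (3 * L) + (3 + (32 / \<gamma>)\<^sup>2) * (2 * c2 * L) + 6144 * (2 * L) / \<kappa>"
    using T K pos L by (intro add_mono mult_left_mono frac_le) auto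
  also have "\<dots> = C / 2 * L"
    by (simp add: C_def \<gamma>_def \<kappa>_def algebra_simps)
  finally have "2 * k / real N * (24 * ln (3 * k / \<delta>) + 3 * K + ((32 / \<gamma> * K)\<^sup>2 + 6144) / K)
      \<le> 2 * k / real N * (C / 2 * L)"
    using k by (intro mult_left_mono) auto
  also have "\<dots> = C * (k * L / real N)"
    by simp
  finally have "add_K_success_prob \<Sigma> P N K
        (2 * k / real N * (24 * ln (3 * k / \<delta>) + 3 * K + ((32 / \<gamma> * K)\<^sup>2 + 6144) / K))
      \<le> add_K_success_prob \<Sigma> P N K (C * (k * L / real N))"
    by (rule add_K_success_prob_mono)
  moreover have "1 - \<delta> \<le> add_K_success_prob \<Sigma> P N K
        (2 * k / real N * (24 * ln (3 * k / \<delta>) + 3 * K + ((32 / \<gamma> * K)\<^sup>2 + 6144) / K))"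
    unfolding k_def using assms a pos K by (intro add_K_success_prob_explicit) auto
  ultimately show ?thesis
    by (simp add: k_def L_def)
qed

(* C is chosen before the alphabet, so it depends only on the implied constants of Theta;
   taking 'a = nat covers finite alphabets of every size with one C. *)
theorem proposition4p1:
  fixes c1 c2 \<delta>0 :: real
  assumes "0 < c1" and "0 < c2" and "0 < \<delta>0" and "\<delta>0 < 1"
  shows "\<exists>C>0. \<forall>(\<delta>::real) (K::real) (\<Sigma>::'a set) (P::'a pmf) (N::nat).
           0 < \<delta> \<longrightarrow> \<delta> \<le> 1 \<longrightarrow> Theta_log_inverse c1 c2 \<delta>0 \<delta> K \<longrightarrow>
           finite \<Sigma> \<longrightarrow> set_pmf P \<subseteq> \<Sigma> \<longrightarrow>
             (1 \<le> N \<longrightarrow>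
               add_K_success_prob \<Sigma> P N K
                 (C * (real (card \<Sigma>) * ln (real (card \<Sigma>) / \<delta>) / real N)) \<ge> 1 - \<delta>) \<and>
             (\<forall>\<epsilon>>0. real N \<ge> C * (real (card \<Sigma>) / \<epsilon> * ln (real (card \<Sigma>) / \<delta>)) \<longrightarrow>
               add_K_success_prob \<Sigma> P N K \<epsilon> \<ge> 1 - \<delta>)"
proof -
  define \<kappa> where "\<kappa> = c1 * min 1 (ln (1 / \<delta>0))"
  define C where "C = 2 * (72 + (3 + (32 / (c1 * min 1 (1 / ln (1 / \<delta>0))))\<^sup>2) * (2 * c2) + 12288 / \<kappa>)"
  have \<kappa>: "0 < \<kappa>"
    using assms by (simp add: \<kappa>_def)
  have C: "0 < C"
    unfolding C_def using \<kappa> assms by (intro mult_pos_pos add_pos_pos add_pos_nonneg) auto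
  have "(1 \<le> N \<longrightarrow> 1 - \<delta> \<le> add_K_success_prob \<Sigma> P N K
            (C * (real (card \<Sigma>) * ln (real (card \<Sigma>) / \<delta>) / real N))) \<and>
        (\<forall>\<epsilon>>0. C * (real (card \<Sigma>) / \<epsilon> * ln (real (card \<Sigma>) / \<delta>)) \<le> real N \<longrightarrow>
            1 - \<delta> \<le> add_K_success_prob \<Sigma> P N K \<epsilon>)"
    if \<delta>: "0 < \<delta>" "\<delta> \<le> 1" and K: "Theta_log_inverse c1 c2 \<delta>0 \<delta> K"
      and \<Sigma>: "finite \<Sigma>" "set_pmf P \<subseteq> \<Sigma>" for \<delta> K and \<Sigma> :: "'a set" and P N
  proof (cases "card \<Sigma> = 1")
    case True
    then obtain x where x: "\<Sigma> = {x}"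
      by (auto simp: card_1_singleton_iff)
    have "\<kappa> \<le> K"
      \<comment> \<open>The maximum keeps the witness for \<open>L\<close> admissible when
        \<open>\<delta>\<close> is near 1 and \<open>ln (1 / \<delta>)\<close> drops below
        \<open>1 / 2\<close>.\<close>
      using Theta_log_inverse_bounds(1)[OF assms \<delta> K, of "max (ln (1 / \<delta>)) (1 / 2)"]
      by (simp add: \<kappa>_def)
    then have one: "add_K_success_prob \<Sigma> P N K r = 1" if "0 \<le> r" for r
      using \<Sigma> \<kappa> that unfolding x by (intro add_K_success_prob_singleton) auto
    have "0 \<le> C * (real (card \<Sigma>) * ln (real (card \<Sigma>) / \<delta>) / real N)"
      using C \<delta> True by simp
    then show ?thesis
      using one \<delta> by (auto simp del: zero_le_mult_iff)
  next
    case False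
    have "card \<Sigma> \<noteq> 0"
      using \<Sigma> set_pmf_not_empty[of P] by auto
    with False have card: "2 \<le> card \<Sigma>"
      by linarith
    have bound: "1 - \<delta> \<le> add_K_success_prob \<Sigma> P N K
        (C * (real (card \<Sigma>) * ln (real (card \<Sigma>) / \<delta>) / real N))" if "1 \<le> N"
      using add_K_success_prob_large_alphabet[OF assms \<delta> K \<Sigma> that card]
      by (simp add: C_def \<kappa>_def)
    moreover have "1 - \<delta> \<le> add_K_success_prob \<Sigma> P N K \<epsilon>"
      if \<epsilon>: "0 < \<epsilon>" and N: "C * (real (card \<Sigma>) / \<epsilon> * ln (real (card \<Sigma>) / \<delta>)) \<le> real N" for \<epsilon>
    proof -
      \<comment> \<open>The sample requirement is therefore strictly positive and forces
        \<open>1 \<le> N\<close>, so \<open>bound\<close> applies.\<close>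
      have "1 < real (card \<Sigma>) / \<delta>"
        using card \<delta> by (simp add: less_divide_eq)
      then have "0 < C * (real (card \<Sigma>) / \<epsilon> * ln (real (card \<Sigma>) / \<delta>))"
        using C \<epsilon> card by (intro mult_pos_pos divide_pos_pos ln_gt_zero) auto
      then have "0 < real N"
        using N by linarith
      moreover from this have "C * (real (card \<Sigma>) * ln (real (card \<Sigma>) / \<delta>) / real N) \<le> \<epsilon>"
        using N \<epsilon> by (simp add: field_simps)
      ultimately show ?thesis
        using bound add_K_success_prob_mono order_trans by (fastforce simp: Suc_le_eq)
    qed
    ultimately show ?thesis by blast
  qed
  with C show ?thesis by blast
qed

end
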